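(* Let $\mu,\mu'$ be two Borel probability measures on $\mathbb{R}^d$ and let $1<p,q<\infty$ with $\frac1p+\frac1q=1$. If $\nu$ is a $(p,q)$-Bessel measure for $\mu*\mu'$, then $|\widehat{\mu'}|^q\,d\nu$ is a $(p,q)$-Bessel measure for $\mu$ with the same bound. If in addition $\nu$ is a $(p,q)$-frame measure for $\mu*\mu'$ with bounds $A$ and $B$, and $c>0$ is a constant such that $c\|f\|_{L^p(\mu)}^q\le\|Pf\|_{L^p(\mu*\mu')}^q$ for all $f\in L^p(\mu)$, then $|\widehat{\mu'}|^q\,d\nu$ is a $(p,q)$-frame measure for $\mu$ with bounds $cA$ and $B$.
   Context: For $f\in L^1(\mu)$, the complex measure $(f\,d\mu)*\mu'$ is absolutely continuous with respect to $\mu*\mu'$, and $Pf=\frac{d((f\,d\mu)*\mu')}{d(\mu*\mu')}$ denotes its Radon–Nikodym derivative; moreover $P$ maps $L^p(\mu)$ into $L^p(\mu*\mu')$ with $\|Pf\|_{L^p(\mu*\mu')}\le\|f\|_{L^p(\mu)}$. The Fourier transform of a finite (complex) measure $\sigma$ is $\widehat{\sigma}(t)=\int e^{-2\pi i t\cdot x}\,d\sigma(x)$. For $t\in\mathbb{R}^d$ let $e_t(x)=e^{2\pi i t\cdot x}$. For a Borel probability measure $\mu$ on $\mathbb{R}^d$ and $f\in L^p(\mu)$, the compatible semi-inner product $[f,g]_{L^p(\mu)}=\|g\|_{L^p(\mu)}^{2-p}\int f|g|^{p-1}\overline{\mathrm{sgn}(g)}\,d\mu$ satisfies $[f,e_t]_{L^p(\mu)}=\widehat{f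 d\mu}(t)=\int f(x)e^{-2\pi i t\cdot x}\,d\mu(x)$. For conjugate exponents $1<p,q<\infty$, a Borel measure $\nu$ on $\mathbb{R}^d$ is a $(p,q)$-Bessel measure for $\mu$ with bound $B>0$ if $\int_{\mathbb{R}^d}|[f,e_t]_{L^p(\mu)}|^q\,d\nu(t)\le B\|f\|_{L^p(\mu)}^q$ for all $f\in L^p(\mu)$, and a $(p,q)$-frame measure with bounds $A,B>0$ if also $A\|f\|_{L^p(\mu)}^q\le\int_{\mathbb{R}^d}|[f,e_t]_{L^p(\mu)}|^q\,d\nu(t)$ for all $f\in L^p(\mu)$. *)

theory Defs
  imports "HOL-Probability.Probability"
begin

text \<open>Elements of \<open>L\<^sup>p(M)\<close> are represented by complex-valued functions, not by classes modulo
  almost everywhere equality; everything below depends only on these classes.\<close>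

definition Lp_space :: "real \<Rightarrow> 'a measure \<Rightarrow> ('a \<Rightarrow> complex) set" where
  "Lp_space p M = {f \<in> borel_measurable M. integrable M (\<lambda>x. cmod (f x) powr p)}"

definition Lp_norm :: "real \<Rightarrow> 'a measure \<Rightarrow> ('a \<Rightarrow> complex) \<Rightarrow> real" where
  "Lp_norm p M f = (LINT x|M. cmod (f x) powr p) powr (1 / p)"

definition Lp_semi_inner ::
    "real \<Rightarrow> 'a measure \<Rightarrow> ('a \<Rightarrow> complex) \<Rightarrow> ('a \<Rightarrow> complex) \<Rightarrow> complex" where
  "Lp_semi_inner p M f g =
     of_real (Lp_norm p M g powr (2 - p)) *
     (LINT x|M. f x * of_real (cmod (g x) powr (p - 1)) * cnj (sgn (g x)))"

definition expo :: "'a::real_inner \<Rightarrow> 'a \<Rightarrow> complex" where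
  "expo t x = exp (2 * of_real pi * \<i> * of_real (t \<bullet> x))"

definition fourier_measure :: "'a::real_inner measure \<Rightarrow> 'a \<Rightarrow> complex" where
  "fourier_measure M t = (LINT x|M. exp (- (2 * of_real pi * \<i> * of_real (t \<bullet> x))))"

text \<open>Complex measures are represented by their set functions. The next definition is \<open>f dM\<close>,
  the one after it is \<open>\<sigma> * N\<close>, via \<open>(\<sigma> * N)(A) = \<integral> \<sigma>(A - y) dN(y)\<close>.\<close>

definition complex_density :: "'a measure \<Rightarrow> ('a \<Rightarrow> complex) \<Rightarrow> 'a set \<Rightarrow> complex" where
  "complex_density M f A = (LINT x:A|M. f x)"

definition complex_convolution ::
    "('a::plus set \<Rightarrow> complex) \<Rightarrow> 'a measure \<Rightarrow> 'a set \<Rightarrow> complex" where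
  "complex_convolution \<sigma> N A = (LINT y|N. \<sigma> {x. x + y \<in> A})"

text \<open>The Radon--Nikodym derivative is unique only up to null sets of \<open>M\<close>; some representative
  is chosen.\<close>

definition complex_RN_deriv :: "'a measure \<Rightarrow> ('a set \<Rightarrow> complex) \<Rightarrow> 'a \<Rightarrow> complex" where
  "complex_RN_deriv M \<sigma> =
     (SOME g. integrable M g \<and> (\<forall>A\<in>sets M. \<sigma> A = (LINT x:A|M. g x)))"

definition P_op ::
    "'a::ordered_euclidean_space measure \<Rightarrow> 'a measure \<Rightarrow> ('a \<Rightarrow> complex) \<Rightarrow> 'a \<Rightarrow> complex" where
  "P_op \<mu> \<mu>' f = complex_RN_deriv (\<mu> \<star> \<mu>') (complex_convolution (complex_density \<mu> f) \<mu>')"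

text \<open>No finiteness of \<open>\<nu>\<close> is required, so the integrals against \<open>\<nu>\<close> are taken in
  \<open>[0, \<infinity>]\<close>.\<close>

definition Bessel_measure ::
    "real \<Rightarrow> real \<Rightarrow> 'a::euclidean_space measure \<Rightarrow> 'a measure \<Rightarrow> real \<Rightarrow> bool" where
  "Bessel_measure p q \<mu> \<nu> B \<longleftrightarrow>
     sets \<nu> = sets borel \<and> B > 0 \<and>
     (\<forall>f\<in>Lp_space p \<mu>.
        (\<integral>\<^sup>+ t. ennreal (cmod (Lp_semi_inner p \<mu> f (expo t)) powr q) \<partial>\<nu>)
          \<le> ennreal (B * Lp_norm p \<mu> f powr q))"

definition frame_measure ::
    "real \<Rightarrow> real \<Rightarrow> 'a::euclidean_space measure \<Rightarrow> 'a measure \<Rightarrow> real \<Rightarrow> real \<Rightarrow> bool" where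
  "frame_measure p q \<mu> \<nu> A B \<longleftrightarrow>
     Bessel_measure p q \<mu> \<nu> B \<and> A > 0 \<and>
     (\<forall>f\<in>Lp_space p \<mu>.
        ennreal (A * Lp_norm p \<mu> f powr q)
          \<le> (\<integral>\<^sup>+ t. ennreal (cmod (Lp_semi_inner p \<mu> f (expo t)) powr q) \<partial>\<nu>))"

end

theory Submission
  imports Defs
begin

text \<open>
  Let \<open>Q = \<mu> \<Otimes> \<mu>'\<close> and \<open>X (x, y) = x + y\<close>, so that \<open>\<mu> \<star> \<mu>'\<close> is the law of \<open>X\<close> under \<open>Q\<close>. Testing
  the definition of \<open>P f\<close> on sets shows that \<open>P f\<close> is the regression function
  \<open>s \<mapsto> E[f (x) | x + y = s]\<close>: for every bounded Borel \<open>\<phi>\<close>,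
  \<open>\<integral> \<phi> (s) (P f) (s) d(\<mu> \<star> \<mu>') = \<integral> \<phi> (x + y) f (x) dQ\<close>
  (\<open>P_op_regression_function\<close>). The theorem follows from two choices of \<open>\<phi>\<close>.

  \<^item> \<open>\<phi>\<close> the conjugate of the character \<open>e\<^sub>t\<close>: as \<open>e\<^sub>t (x + y) = e\<^sub>t (x) e\<^sub>t (y)\<close>, Fubini's theorem
    gives \<open>[P f, e\<^sub>t] = \<mu>'^(t) [f, e\<^sub>t]\<close> (\<open>Lp_semi_inner_P_op\<close>). Hence the integral of
    \<open>|[f, e\<^sub>t]|\<^sup>q\<close> against \<open>|\<mu>'^|\<^sup>q d\<nu>\<close> equals the integral of \<open>|[P f, e\<^sub>t]|\<^sup>q\<close> against \<open>\<nu>\<close>.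
  \<^item> \<open>\<phi>\<close> a truncation of the function \<open>|P f|\<^sup>p\<^sup>-\<^sup>1 cnj (sgn (P f))\<close>, which is dual to \<open>P f\<close>: this
    gives \<open>\<parallel>P f\<parallel>\<^sub>p \<le> \<parallel>f\<parallel>\<^sub>p\<close> (\<open>regression_function_contraction\<close>).

  The bounds of \<open>\<nu>\<close> for the function \<open>P f\<close> therefore are bounds of \<open>|\<mu>'^|\<^sup>q d\<nu>\<close> for \<open>f\<close>, after
  \<open>\<parallel>P f\<parallel>\<close> is compared with \<open>\<parallel>f\<parallel>\<close>: from above by the contraction property and from below by
  the hypothesis on \<open>c\<close>.
\<close>

section \<open>Regression functions\<close>

text \<open>This says \<open>g (x) = E[f | X = x]\<close>, for complex \<open>f\<close> and with \<open>g\<close> living on the target of \<open>X\<close>.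
  Bounded test functions rather than indicators are used because the characters and the
  function dual to \<open>g\<close> are the test functions of interest.\<close>


definition regression_function ::
    "'a measure \<Rightarrow> 'b measure \<Rightarrow> ('a \<Rightarrow> 'b) \<Rightarrow> ('a \<Rightarrow> complex) \<Rightarrow> ('b \<Rightarrow> complex) \<Rightarrow> bool" where
  "regression_function Q N X f g \<longleftrightarrow>
     integrable (distr Q N X) g \<and>
     (\<forall>\<phi>\<in>borel_measurable N. \<forall>C. (\<forall>x. cmod (\<phi> x) \<le> C) \<longrightarrow>
        (LINT x|distr Q N X. \<phi> x * g x) = (LINT z|Q. \<phi> (X z) * f z))"

lemma regression_function_integral:
  assumes "regression_function Q N X f g" "\<phi> \<in> borel_measurable N" "\<And>x. cmod (\<phi> x) \<le> C"
  shows "(LINT x|distr Q N X. \<phi> x * g x) = (LINT z|Q. \<phi> (X z) * f z)"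
  using assms unfolding regression_function_def by blast

lemma borel_measurable_cnj: "cnj \<in> borel_measurable borel"
  by (intro borel_measurable_continuous_onI continuous_intros)

lemma borel_measurable_sgn: "(sgn :: complex \<Rightarrow> complex) \<in> borel_measurable borel"
  unfolding sgn_div_norm by measurable

lemma integrable_bounded_mult:
  fixes \<phi> g :: "'a \<Rightarrow> complex"
  assumes "integrable M g" "\<phi> \<in> borel_measurable M" "\<And>x. cmod (\<phi> x) \<le> C"
  shows "integrable M (\<lambda>x. \<phi> x * g x)"
proof (rule Bochner_Integration.integrable_bound[where f = "\<lambda>x. C * cmod (g x)"])
  show "integrable M (\<lambda>x. C * cmod (g x))"
    using assms by auto
  show "(\<lambda>x. \<phi> x * g x) \<in> borel_measurable M"
    using assms by measurable
  show "AE x in M. norm (\<phi> x * g x) \<le> norm (C * cmod (g x))"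
    using assms(3)
    by (intro AE_I2) (simp add: norm_mult order_trans[OF mult_right_mono abs_ge_self])
qed

text \<open>The existence proof assembles a complex function from nonnegative ones by means of this
  closure property.\<close>

lemma regression_function_linear:
  assumes "X \<in> measurable Q N" "integrable Q f" "integrable Q f'"
    and "regression_function Q N X f g" "regression_function Q N X f' g'"
  shows "regression_function Q N X (\<lambda>z. f z + c * f' z) (\<lambda>x. g x + c * g' x)"
  unfolding regression_function_def
proof (intro conjI ballI allI impI)
  show "integrable (distr Q N X) (\<lambda>x. g x + c * g' x)"
    using assms(4,5) by (auto simp: regression_function_def)
  fix \<phi> :: "_ \<Rightarrow> complex" and C assume \<phi>[measurable]: "\<phi> \<in> borel_measurable N" and C: "\<forall>x. cmod (\<phi> x) \<le> C"
  note [measurable] = assms(1)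
  have b: "integrable (distr Q N X) (\<lambda>x. \<phi> x * g x)" "integrable (distr Q N X) (\<lambda>x. \<phi> x * g' x)"
    using assms(4,5) C by (auto simp: regression_function_def intro!: integrable_bounded_mult)
  have a: "integrable Q (\<lambda>z. \<phi> (X z) * f z)" "integrable Q (\<lambda>z. \<phi> (X z) * f' z)"
    using assms(2,3) C by (auto intro!: integrable_bounded_mult)
  have "(LINT x|distr Q N X. \<phi> x * (g x + c * g' x)) =
      (LINT x|distr Q N X. \<phi> x * g x + c * (\<phi> x * g' x))"
    by (simp add: algebra_simps)
  also have "\<dots> = (LINT x|distr Q N X. \<phi> x * g x) + c * (LINT x|distr Q N X. \<phi> x * g' x)"
    using b by simp
  also have "\<dots> = (LINT z|Q. \<phi> (X z) * f z) + c * (LINT z|Q. \<phi> (X z) * f' z)"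
    using C by (simp add: regression_function_integral[OF assms(4) \<phi>, of C]
        regression_function_integral[OF assms(5) \<phi>, of C])
  also have "\<dots> = (LINT z|Q. \<phi> (X z) * f z + c * (\<phi> (X z) * f' z))"
    using a by simp
  finally show "(LINT x|distr Q N X. \<phi> x * (g x + c * g' x)) =
      (LINT z|Q. \<phi> (X z) * (f z + c * f' z))"
    by (simp add: algebra_simps)
qed

text \<open>For \<open>f \<ge> 0\<close> the image under \<open>X\<close> of the finite measure \<open>f dQ\<close> is absolutely continuous with
  respect to the image of \<open>Q\<close>; its Radon--Nikodym derivative is the regression function.\<close>

lemma regression_function_exists_nonneg:
  fixes f :: "'a \<Rightarrow> real"
  assumes "finite_measure Q" and X[measurable]: "X \<in> measurable Q N"
    and f: "integrable Q f" and nonneg: "\<And>z. 0 \<le> f z"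
  shows "\<exists>g. regression_function Q N X (\<lambda>z. of_real (f z)) g"
proof -
  interpret Q: finite_measure Q by fact
  note [measurable] = borel_measurable_integrable[OF f]
  define M where "M = distr Q N X"
  define D where "D = distr (density Q f) N X"
  interpret M: finite_measure M unfolding M_def by (rule Q.finite_measure_distr) fact
  have fin: "finite_measure D"
  proof (rule finite_measureI)
    have "emeasure D (space D) = (\<integral>\<^sup>+ z. ennreal (f z) \<partial>Q)"
      unfolding D_def by (subst emeasure_distr)
        (auto simp: emeasure_density measurable_space[OF X] intro!: nn_integral_cong)
    also have "\<dots> < \<infinity>"
      using f nonneg by (subst nn_integral_eq_integral) auto
    finally show "emeasure D (space D) \<noteq> \<infinity>" by simp
  qed
  have ac: "absolutely_continuous M D"
    unfolding absolutely_continuous_def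
  proof
    fix A assume A: "A \<in> null_sets M"
    hence [measurable]: "A \<in> sets N" by (auto simp: M_def null_sets_def)
    have "X -` A \<inter> space Q \<in> null_sets Q"
      using A by (auto simp: M_def null_sets_def emeasure_distr)
    hence "X -` A \<inter> space Q \<in> null_sets (density Q f)"
      using null_sets_density_iff[of f Q] by (auto dest: AE_not_in elim: eventually_mono)
    thus "A \<in> null_sets D" by (auto simp: D_def null_sets_def emeasure_distr)
  qed
  have sets: "sets D = sets M" by (simp add: D_def M_def)
  obtain g where g: "g \<in> borel_measurable M" "AE x in M. RN_deriv M D x = ennreal (g x)"
      "\<And>x. 0 \<le> g x"
    using M.real_RN_deriv[OF fin ac sets] by blast
  note [measurable] = g(1)
  have D: "density M g = D"
    using M.density_RN_deriv[OF ac sets] density_cong[OF _ _ g(2)] by simp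
  have eq: "(LINT x|M. \<phi> x * of_real (g x)) = (LINT z|Q. \<phi> (X z) * of_real (f z))"
    if [measurable]: "\<phi> \<in> borel_measurable N" for \<phi> :: "_ \<Rightarrow> complex"
  proof -
    have "(LINT x|M. \<phi> x * of_real (g x)) = integral\<^sup>L D \<phi>"
      unfolding D[symmetric] using g by (subst integral_density)
        (auto simp: scaleR_conv_of_real mult.commute M_def)
    also have "\<dots> = (LINT z|Q. \<phi> (X z) * of_real (f z))"
      unfolding D_def using nonneg
      by (subst integral_distr, simp, simp, subst integral_density)
        (auto simp: scaleR_conv_of_real mult.commute)
    finally show ?thesis .
  qed
  have "integrable (density M g) (\<lambda>x. 1::real)"
    unfolding D using finite_measure.integrable_const[OF fin] by blast
  hence "integrable M g"
    using g by (subst (asm) integrable_density) auto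
  thus ?thesis
    using eq unfolding regression_function_def M_def
    by (intro exI[of _ "\<lambda>x. of_real (g x)"]) auto
qed

lemma regression_function_exists:
  assumes "finite_measure Q" and X: "X \<in> measurable Q N" and f: "integrable Q f"
  shows "\<exists>g. regression_function Q N X f g"
proof -
  have real: "\<exists>g. regression_function Q N X (\<lambda>z. of_real (h z)) g"
    if h: "integrable Q h" for h :: "_ \<Rightarrow> real"
  proof -
    obtain g1 where g1: "regression_function Q N X (\<lambda>z. of_real (max (h z) 0)) g1"
      using regression_function_exists_nonneg[OF assms(1) X, of "\<lambda>z. max (h z) 0"] h by auto
    obtain g2 where g2: "regression_function Q N X (\<lambda>z. of_real (max (- h z) 0)) g2"
      using regression_function_exists_nonneg[OF assms(1) X, of "\<lambda>z. max (- h z) 0"] h by auto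
    have "complex_of_real (max (h z) 0) + (-1) * complex_of_real (max (- h z) 0) = of_real (h z)" for z
      by (auto simp: max_def)
    thus ?thesis
      using regression_function_linear[OF X _ _ g1 g2, of "-1"] h by auto
  qed
  obtain g1 g2 where g: "regression_function Q N X (\<lambda>z. of_real (Re (f z))) g1"
      "regression_function Q N X (\<lambda>z. of_real (Im (f z))) g2"
    using real[of "\<lambda>z. Re (f z)"] real[of "\<lambda>z. Im (f z)"] f by auto
  show ?thesis
    using regression_function_linear[OF X _ _ g, of \<i>] f by (auto simp: complex_eq[symmetric])
qed

text \<open>This is the conditional Jensen inequality for \<open>|\<cdot>|\<^sup>p\<close>, obtained by duality, which treats
  complex values directly. Write \<open>T\<close> for \<open>|g|\<^sup>p\<close> cut off to \<open>0\<close> where \<open>|g| > n\<close>, and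
  \<open>\<phi>\<close> for \<open>|g|\<^sup>p\<^sup>-\<^sup>1 cnj (sgn g)\<close> cut off in the same way. Then \<open>\<phi> g = T = |\<phi>|\<^sup>q\<close> for the conjugate
  exponent \<open>q\<close>, so testing with \<open>\<phi>\<close> and Young's inequality give
  \<open>\<integral> T \<le> \<integral> |\<phi> (X)| |f| \<le> (\<integral> |f|\<^sup>p) / p + (\<integral> T) / q\<close>.
  The cut-off makes \<open>\<integral> T\<close> finite, so it can be absorbed on the left, which leaves
  \<open>\<integral> T \<le> \<integral> |f|\<^sup>p\<close>; finally let \<open>n \<rightarrow> \<infinity>\<close>.\<close>

lemma regression_function_contraction:
  assumes "finite_measure Q" and X[measurable]: "X \<in> measurable Q N"
    and p: "1 < p"
    and f: "f \<in> Lp_space p Q" and g: "regression_function Q N X f g"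
  shows "g \<in> Lp_space p (distr Q N X)" and "Lp_norm p (distr Q N X) g \<le> Lp_norm p Q f"
proof -
  interpret Q: finite_measure Q by fact
  define M where "M = distr Q N X"
  interpret M: finite_measure M unfolding M_def by (rule Q.finite_measure_distr) fact
  define q where "q = p / (p - 1)"
  have q: "1 < q" "1 / p + 1 / q = 1" "(p - 1) * q = p" using p by (auto simp: q_def field_simps)
  have fm[measurable]: "f \<in> borel_measurable Q" and fp: "integrable Q (\<lambda>z. cmod (f z) powr p)"
    using f by (auto simp: Lp_space_def)
  have gM: "integrable M g" using g by (simp add: regression_function_def M_def)
  hence gm: "g \<in> borel_measurable M" by simp
  hence gmN[measurable]: "g \<in> borel_measurable N" by (simp add: M_def)
  define T where "T n x = (if cmod (g x) \<le> real n then cmod (g x) powr p else 0)" for n :: nat and x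
  have Tm[measurable]: "T n \<in> borel_measurable N" for n unfolding T_def by measurable
  have Tb: "\<bar>T n x\<bar> \<le> real n powr p" for n x
    using p by (auto simp: T_def intro!: powr_mono2)
  have Ti: "integrable M (T n)" for n
    by (rule M.integrable_const_bound[where B = "real n powr p"]) (use Tb in \<open>auto simp: M_def\<close>)
  have trunc: "(LINT x|M. T n x) \<le> (LINT z|Q. cmod (f z) powr p)" for n
  proof -
    define \<phi> where "\<phi> x = (if cmod (g x) \<le> real n
        then cnj (sgn (g x)) * of_real (cmod (g x) powr (p - 1)) else 0)" for x
    have \<phi>m[measurable]: "\<phi> \<in> borel_measurable N"
      unfolding \<phi>_def using borel_measurable_cnj borel_measurable_sgn by measurable
    have cm: "cmod (\<phi> x) = (if cmod (g x) \<le> real n then cmod (g x) powr (p - 1) else 0)" for x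
      by (auto simp: \<phi>_def norm_mult norm_sgn)
    have \<phi>b: "\<forall>x. cmod (\<phi> x) \<le> real n powr (p - 1)"
      unfolding cm using p by (auto intro!: powr_mono2)
    have "\<phi> x * g x = of_real (T n x)" for x
    proof (cases "g x = 0 \<or> \<not> cmod (g x) \<le> real n")
      case True thus ?thesis by (auto simp: \<phi>_def T_def)
    next
      case False
      have "cnj (sgn (g x)) * g x = of_real (cmod (g x))"
        using False
        by (simp add: sgn_div_norm scaleR_conv_of_real complex_norm_square[symmetric] field_simps power2_eq_square)
      moreover have "cmod (g x) * cmod (g x) powr (p - 1) = cmod (g x) powr p"
        using False by (simp add: powr_mult_base)
      ultimately show ?thesis using False
        by (simp add: \<phi>_def T_def) (metis mult.assoc mult.commute of_real_mult)
    qed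
    hence "complex_of_real (LINT x|M. T n x) = (LINT x|M. \<phi> x * g x)" by simp
    also have "\<dots> = (LINT z|Q. \<phi> (X z) * f z)"
      unfolding M_def using \<phi>b by (intro regression_function_integral[OF g \<phi>m]) blast
    finally have e: "complex_of_real (LINT x|M. T n x) = (LINT z|Q. \<phi> (X z) * f z)" .
    have TQ: "(LINT x|M. T n x) = (LINT z|Q. T n (X z))"
      unfolding M_def by (rule integral_distr) auto
    have TQi: "integrable Q (\<lambda>z. T n (X z))"
      using Ti[of n] unfolding M_def by (subst (asm) integrable_distr_eq) auto
    have young: "cmod (\<phi> (X z) * f z) \<le> cmod (f z) powr p / p + T n (X z) / q" for z
    proof -
      have "cmod (f z) * cmod (\<phi> (X z)) \<le> cmod (f z) powr p / p + cmod (\<phi> (X z)) powr q / q"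
        using p q by (intro Youngs_inequality) auto
      also have "cmod (\<phi> (X z)) powr q = T n (X z)"
        using q by (auto simp: cm T_def powr_powr)
      finally show ?thesis by (simp add: norm_mult mult.commute)
    qed
    have nn: "0 \<le> (LINT x|M. T n x)" by (rule Bochner_Integration.integral_nonneg) (simp add: T_def)
    have "(LINT x|M. T n x) = cmod (LINT z|Q. \<phi> (X z) * f z)"
      unfolding e[symmetric] using nn by simp
    also have "\<dots> \<le> (LINT z|Q. cmod (\<phi> (X z) * f z))" by (rule integral_norm_bound)
    also have "\<dots> \<le> (LINT z|Q. cmod (f z) powr p / p + T n (X z) / q)"
    proof (rule integral_mono)
      show i: "integrable Q (\<lambda>z. cmod (f z) powr p / p + T n (X z) / q)" using fp TQi by auto
      show "integrable Q (\<lambda>z. cmod (\<phi> (X z) * f z))"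
        by (rule Bochner_Integration.integrable_bound[OF i])
           (use young in \<open>auto intro!: AE_I2 intro: order_trans[OF _ abs_ge_self]\<close>)
    qed (rule young)
    also have "\<dots> = (LINT z|Q. cmod (f z) powr p) / p + (LINT x|M. T n x) / q"
      using fp TQi by (simp add: TQ)
    finally have "(LINT x|M. T n x) * (1 - 1 / q) \<le> (LINT z|Q. cmod (f z) powr p) / p"
      by (simp add: algebra_simps)
    moreover have "1 - 1 / q = 1 / p" using q by simp
    ultimately show ?thesis using p by (simp add: divide_le_cancel)
  qed
  have lim: "(\<lambda>n. T n x) \<longlonglongrightarrow> cmod (g x) powr p" for x
  proof (rule tendsto_eventually)
    obtain m where "cmod (g x) \<le> real m" using real_arch_simple by blast
    thus "\<forall>\<^sub>F n in sequentially. T n x = cmod (g x) powr p"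
      unfolding T_def by (intro eventually_sequentiallyI[of m]) auto
  qed
  have mono: "mono (\<lambda>n. T n x)" for x
    by (auto simp: T_def mono_def)
  have bnd: "(\<integral>\<^sup>+x. ennreal (cmod (g x) powr p) \<partial>M) \<le> ennreal (LINT z|Q. cmod (f z) powr p)"
  proof (rule LIMSEQ_le_const2)
    show "(\<lambda>n. \<integral>\<^sup>+x. ennreal (T n x) \<partial>M) \<longlonglongrightarrow> (\<integral>\<^sup>+x. ennreal (cmod (g x) powr p) \<partial>M)"
      by (rule nn_integral_LIMSEQ)
         (use lim mono in \<open>auto simp: incseq_def le_fun_def mono_def M_def intro!: ennreal_leI tendsto_ennrealI\<close>)
    have "(\<integral>\<^sup>+x. ennreal (T n x) \<partial>M) = ennreal (LINT x|M. T n x)" for n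
      by (rule nn_integral_eq_integral[OF Ti]) (simp add: T_def)
    thus "\<exists>N. \<forall>n\<ge>N. (\<integral>\<^sup>+x. ennreal (T n x) \<partial>M) \<le> ennreal (LINT z|Q. cmod (f z) powr p)"
      using trunc by (auto intro!: ennreal_leI)
  qed
  have gi: "integrable M (\<lambda>x. cmod (g x) powr p)"
  proof (rule integrableI_nonneg)
    show "(\<lambda>x. cmod (g x) powr p) \<in> borel_measurable M" by (simp add: M_def)
    show "(\<integral>\<^sup>+x. ennreal (cmod (g x) powr p) \<partial>M) < \<infinity>" using bnd by (auto intro: le_less_trans)
  qed simp
  show "g \<in> Lp_space p (distr Q N X)"
    using gi gm by (simp add: Lp_space_def M_def)
  have "(LINT x|M. cmod (g x) powr p) \<le> (LINT z|Q. cmod (f z) powr p)"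
    using bnd gi by (subst (asm) nn_integral_eq_integral) (auto simp: ennreal_le_iff)
  thus "Lp_norm p (distr Q N X) g \<le> Lp_norm p Q f"
    unfolding Lp_norm_def M_def[symmetric] using p by (intro powr_mono2) auto
qed


section \<open>The operator P as a regression function\<close>

lemma Lp_space_imp_integrable:
  assumes "finite_measure M" "1 \<le> p" "f \<in> Lp_space p M"
  shows "integrable M f"
proof (rule Bochner_Integration.integrable_bound[where f = "\<lambda>x. 1 + cmod (f x) powr p"])
  interpret finite_measure M by fact
  show "integrable M (\<lambda>x. 1 + cmod (f x) powr p)" "f \<in> borel_measurable M"
    using assms(3) by (auto simp: Lp_space_def)
  show "AE x in M. norm (f x) \<le> norm (1 + cmod (f x) powr p)"
  proof (rule AE_I2)
    fix x
    show "norm (f x) \<le> norm (1 + cmod (f x) powr p)"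
    proof (cases "1 \<le> cmod (f x)")
      case True
      thus ?thesis using powr_mono[OF assms(2) True] by simp
    next
      case False
      thus ?thesis by (simp add: add_increasing2)
    qed
  qed
qed

lemma scaleR_indicator: "indicator A x *\<^sub>R z = (indicator A x * z :: complex)"
  by (simp add: indicator_def)

text \<open>By Fubini's theorem a regression function \<open>g\<close> of \<open>f (x)\<close> on \<open>x + y\<close> has the integrals over
  sets that are required of a derivative of \<open>(f d\<mu>) * \<mu>'\<close>. So the choice made in \<open>P_op\<close> does
  yield a derivative, and derivatives are unique up to null sets.\<close>

lemma P_op_regression_function:
  fixes \<mu> \<mu>' :: "'a::ordered_euclidean_space measure"
  assumes "prob_space \<mu>" and sets[measurable_cong]: "sets \<mu> = sets borel"
    and "prob_space \<mu>'" and sets'[measurable_cong]: "sets \<mu>' = sets borel"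
    and f: "integrable \<mu> f"
  shows "regression_function (\<mu> \<Otimes>\<^sub>M \<mu>') borel (\<lambda>(x, y). x + y) (\<lambda>z. f (fst z)) (P_op \<mu> \<mu>' f)"
proof -
  interpret \<mu>: prob_space \<mu> by fact
  interpret \<mu>': prob_space \<mu>' by fact
  interpret Q: pair_prob_space \<mu> \<mu>' ..
  let ?Q = "\<mu> \<Otimes>\<^sub>M \<mu>'" and ?X = "\<lambda>(x, y). x + y :: 'a"
  note [measurable] = borel_measurable_integrable[OF f]
  have X: "?X \<in> measurable ?Q borel" by measurable
  have conv: "distr ?Q borel ?X = (\<mu> \<star> \<mu>')" by (simp add: convolution_def)
  have fQ: "integrable ?Q (\<lambda>z. f (fst z))"
    using f \<mu>'.distr_pair_fst[of \<mu>] by (metis integrable_distr measurable_fst)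
  interpret M: prob_space "\<mu> \<star> \<mu>'"
    unfolding conv[symmetric] by (rule Q.prob_space_distr[OF X])
  obtain g where g: "regression_function ?Q borel ?X (\<lambda>z. f (fst z)) g"
    using regression_function_exists[OF _ X fQ] Q.finite_measure by blast
  hence gi: "integrable (\<mu> \<star> \<mu>') g" by (simp add: regression_function_def conv)
  let ?\<sigma> = "complex_convolution (complex_density \<mu> f) \<mu>'"
  have g\<sigma>: "?\<sigma> A = (LINT x:A|(\<mu> \<star> \<mu>'). g x)" if A[measurable]: "A \<in> sets borel" for A
  proof -
    have ind: "integrable ?Q (\<lambda>z. indicator A (?X z) * f (fst z))"
      by (rule integrable_bounded_mult[OF fQ, where C = 1]) (auto simp: indicator_def)
    have translate: "indicator {x. x + y \<in> A} x = (indicator A (x + y) :: complex)" for x y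
      by (simp add: indicator_def)
    have "?\<sigma> A = (LINT y|\<mu>'. LINT x|\<mu>. indicator A (x + y) * f x)"
      by (simp add: complex_convolution_def complex_density_def set_lebesgue_integral_def
          scaleR_indicator translate)
    also have "\<dots> = (LINT z|?Q. indicator A (?X z) * f (fst z))"
      using Q.integral_snd[of "\<lambda>x y. indicator A (x + y) * f x"] ind by (simp add: case_prod_beta')
    also have "\<dots> = (LINT x|(\<mu> \<star> \<mu>'). indicator A x * g x)"
      using regression_function_integral[OF g, of "indicator A" 1] by (simp add: conv indicator_def[abs_def])
    finally show ?thesis
      by (simp add: set_lebesgue_integral_def scaleR_indicator)
  qed
  have P: "integrable (\<mu> \<star> \<mu>') (P_op \<mu> \<mu>' f) \<and>
      (\<forall>A\<in>sets (\<mu> \<star> \<mu>'). ?\<sigma> A = (LINT x:A|(\<mu> \<star> \<mu>'). P_op \<mu> \<mu>' f x))"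
    unfolding P_op_def complex_RN_deriv_def
    by (rule someI[where x = g]) (use gi g\<sigma> in auto)
  hence Pi: "integrable (\<mu> \<star> \<mu>') (P_op \<mu> \<mu>' f)" by blast
  have ae: "AE x in (\<mu> \<star> \<mu>'). P_op \<mu> \<mu>' f x = g x"
    by (rule M.density_unique_banach) (use P gi g\<sigma> in auto)
  have [measurable]: "P_op \<mu> \<mu>' f \<in> borel_measurable borel" "g \<in> borel_measurable borel"
    using borel_measurable_integrable[OF Pi] borel_measurable_integrable[OF gi] by simp_all
  have "(LINT x|(\<mu> \<star> \<mu>'). \<phi> x * P_op \<mu> \<mu>' f x) = (LINT x|(\<mu> \<star> \<mu>'). \<phi> x * g x)"
    if [measurable]: "\<phi> \<in> borel_measurable borel" for \<phi>
    by (rule integral_cong_AE) (use ae in auto)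
  thus ?thesis
    using g Pi unfolding regression_function_def conv by auto
qed

text \<open>The coordinate projection has law \<open>\<mu>\<close>, so passing from \<open>f\<close> to \<open>f (x)\<close> on the product space
  keeps the norm, and conditioning on the sum does not increase it.\<close>

lemma P_op_contraction:
  fixes \<mu> \<mu>' :: "'a::ordered_euclidean_space measure"
  assumes "prob_space \<mu>" and sets[measurable_cong]: "sets \<mu> = sets borel"
    and "prob_space \<mu>'" and sets'[measurable_cong]: "sets \<mu>' = sets borel"
    and p: "1 < p" and f: "f \<in> Lp_space p \<mu>"
  shows "P_op \<mu> \<mu>' f \<in> Lp_space p (\<mu> \<star> \<mu>')"
    and "Lp_norm p (\<mu> \<star> \<mu>') (P_op \<mu> \<mu>' f) \<le> Lp_norm p \<mu> f"
proof -
  interpret \<mu>: prob_space \<mu> by fact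
  interpret \<mu>': prob_space \<mu>' by fact
  interpret Q: pair_prob_space \<mu> \<mu>' ..
  let ?Q = "\<mu> \<Otimes>\<^sub>M \<mu>'" and ?X = "\<lambda>(x, y). x + y :: 'a"
  have fm[measurable]: "f \<in> borel_measurable \<mu>" and fp: "integrable \<mu> (\<lambda>x. cmod (f x) powr p)"
    using f by (auto simp: Lp_space_def)
  have fi: "integrable \<mu> f"
    using Lp_space_imp_integrable[OF _ _ f] p \<mu>.finite_measure by simp
  have X: "?X \<in> measurable ?Q borel" by measurable
  have "integrable ?Q (\<lambda>z. cmod (f (fst z)) powr p)"
    using fp \<mu>'.distr_pair_fst[of \<mu>]
      integrable_distr[of fst ?Q \<mu> "\<lambda>x. cmod (f x) powr p"] by simp
  hence fQ: "(\<lambda>z. f (fst z)) \<in> Lp_space p ?Q"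
    by (simp add: Lp_space_def)
  have norm: "Lp_norm p ?Q (\<lambda>z. f (fst z)) = Lp_norm p \<mu> f"
    using \<mu>'.distr_pair_fst[of \<mu>]
      integral_distr[of fst ?Q \<mu> "\<lambda>x. cmod (f x) powr p"] by (simp add: Lp_norm_def)
  note contr = regression_function_contraction[OF Q.finite_measure X p fQ
      P_op_regression_function[OF assms(1-4) fi]]
  show "P_op \<mu> \<mu>' f \<in> Lp_space p (\<mu> \<star> \<mu>')"
    and "Lp_norm p (\<mu> \<star> \<mu>') (P_op \<mu> \<mu>' f) \<le> Lp_norm p \<mu> f"
    using contr by (simp_all add: norm convolution_def)
qed

section \<open>Pairing with characters\<close>

lemma cmod_expo [simp]: "cmod (expo t x) = 1"
  by (simp add: expo_def)

lemma cnj_expo: "cnj (expo t x) = exp (- (2 * of_real pi * \<i> * of_real (t \<bullet> x)))"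
  by (simp add: expo_def exp_cnj)

lemma expo_add: "expo t (x + y) = expo t x * expo t y"
  by (simp add: expo_def inner_add_right exp_add[symmetric] algebra_simps)

lemma fourier_measure_expo: "fourier_measure M t = (LINT x|M. cnj (expo t x))"
  by (simp add: fourier_measure_def cnj_expo)

lemma borel_measurable_cnj_expo [measurable]:
  "(\<lambda>(t, x :: 'a::euclidean_space). cnj (expo t x)) \<in> borel_measurable (borel \<Otimes>\<^sub>M borel)"
  unfolding cnj_expo by measurable

text \<open>Since \<open>|e\<^sub>t| = 1\<close> and \<open>M\<close> has mass one, the norm factor and the power of \<open>|e\<^sub>t|\<close> in the
  semi-inner product are both \<open>1\<close>.\<close>

lemma Lp_semi_inner_expo:
  assumes "prob_space M"
  shows "Lp_semi_inner p M f (expo t) = (LINT x|M. f x * cnj (expo t x))"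
proof -
  interpret prob_space M by fact
  show ?thesis
    by (simp add: Lp_semi_inner_def Lp_norm_def prob_space sgn_div_norm)
qed

lemma borel_measurable_Lp_semi_inner_expo:
  fixes M :: "'a::euclidean_space measure"
  assumes "prob_space M" and [measurable_cong]: "sets M = sets borel"
    and [measurable]: "f \<in> borel_measurable M"
  shows "(\<lambda>t. Lp_semi_inner p M f (expo t)) \<in> borel_measurable borel"
proof -
  interpret prob_space M by fact
  show ?thesis unfolding Lp_semi_inner_expo[OF assms(1)] by measurable
qed

lemma borel_measurable_fourier_measure:
  fixes M :: "'a::euclidean_space measure"
  assumes "prob_space M" and [measurable_cong]: "sets M = sets borel"
  shows "fourier_measure M \<in> borel_measurable borel"
proof -
  interpret prob_space M by fact
  show ?thesis unfolding fourier_measure_expo[abs_def] by measurable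
qed

text \<open>Characters turn the sum \<open>x + y\<close> into a product, so the double integral splits.\<close>

lemma Lp_semi_inner_P_op:
  fixes \<mu> \<mu>' :: "'a::ordered_euclidean_space measure"
  assumes "prob_space \<mu>" and sets[measurable_cong]: "sets \<mu> = sets borel"
    and "prob_space \<mu>'" and sets'[measurable_cong]: "sets \<mu>' = sets borel"
    and f: "integrable \<mu> f"
  shows "Lp_semi_inner p (\<mu> \<star> \<mu>') (P_op \<mu> \<mu>' f) (expo t) =
    fourier_measure \<mu>' t * Lp_semi_inner p \<mu> f (expo t)"
proof -
  interpret \<mu>: prob_space \<mu> by fact
  interpret \<mu>': prob_space \<mu>' by fact
  interpret Q: pair_prob_space \<mu> \<mu>' ..
  let ?Q = "\<mu> \<Otimes>\<^sub>M \<mu>'" and ?X = "\<lambda>(x, y). x + y :: 'a"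
  note [measurable] = borel_measurable_integrable[OF f]
  have X[measurable]: "?X \<in> measurable ?Q borel" by measurable
  have conv: "distr ?Q borel ?X = (\<mu> \<star> \<mu>')" by (simp add: convolution_def)
  have prob: "prob_space (\<mu> \<star> \<mu>')"
    unfolding convolution_def by (rule Q.prob_space_distr) measurable
  have fQ: "integrable ?Q (\<lambda>z. f (fst z))"
    using f \<mu>'.distr_pair_fst[of \<mu>] by (metis integrable_distr measurable_fst)
  have em: "(\<lambda>x. cnj (expo t x)) \<in> borel_measurable borel" by measurable
  have ind: "integrable ?Q (\<lambda>z. cnj (expo t (?X z)) * f (fst z))"
    by (rule integrable_bounded_mult[OF fQ, where C = 1]) (simp_all, measurable)
  have "Lp_semi_inner p (\<mu> \<star> \<mu>') (P_op \<mu> \<mu>' f) (expo t) =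
      (LINT x|(\<mu> \<star> \<mu>'). cnj (expo t x) * P_op \<mu> \<mu>' f x)"
    by (simp add: Lp_semi_inner_expo[OF prob] mult.commute)
  also have "\<dots> = (LINT z|?Q. cnj (expo t (?X z)) * f (fst z))"
    using regression_function_integral[OF P_op_regression_function[OF assms] em, of 1]
    by (simp add: conv)
  also have "\<dots> = (LINT y|\<mu>'. LINT x|\<mu>. cnj (expo t (x + y)) * f x)"
    using Q.integral_snd[of "\<lambda>x y. cnj (expo t (x + y)) * f x"] ind by (simp add: case_prod_beta')
  also have "\<dots> = (LINT y|\<mu>'. cnj (expo t y) * (LINT x|\<mu>. f x * cnj (expo t x)))"
    by (simp add: expo_add ac_simps flip: integral_mult_right_zero)
  also have "\<dots> = fourier_measure \<mu>' t * Lp_semi_inner p \<mu> f (expo t)"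
    by (simp add: fourier_measure_expo Lp_semi_inner_expo[OF assms(1)])
  finally show ?thesis .
qed

section \<open>Transfer of Bessel and frame measures\<close>

theorem proposition4p10:
  fixes \<mu> \<mu>' \<nu> :: "(real ^ 'n) measure" and p q :: real
  assumes "prob_space \<mu>" and "sets \<mu> = sets borel"
    and "prob_space \<mu>'" and "sets \<mu>' = sets borel"
    and "sets \<nu> = sets borel"
    and "1 < p" and "1 < q" and "1 / p + 1 / q = 1"
  shows "(\<forall>B. Bessel_measure p q (\<mu> \<star> \<mu>') \<nu> B \<longrightarrow>
            Bessel_measure p q \<mu> (density \<nu> (\<lambda>t. ennreal (cmod (fourier_measure \<mu>' t) powr q))) B)
       \<and> (\<forall>A B c. frame_measure p q (\<mu> \<star> \<mu>') \<nu> A B \<longrightarrow> c > 0 \<longrightarrow>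
            (\<forall>f\<in>Lp_space p \<mu>.
               c * Lp_norm p \<mu> f powr q \<le> Lp_norm p (\<mu> \<star> \<mu>') (P_op \<mu> \<mu>' f) powr q) \<longrightarrow>
            frame_measure p q \<mu>
              (density \<nu> (\<lambda>t. ennreal (cmod (fourier_measure \<mu>' t) powr q))) (c * A) B)"
proof -
  define \<nu>' where "\<nu>' = density \<nu> (\<lambda>t. ennreal (cmod (fourier_measure \<mu>' t) powr q))"
  note contr = P_op_contraction[OF assms(1-4,6)]
  have transfer: "(\<integral>\<^sup>+ t. ennreal (cmod (Lp_semi_inner p \<mu> f (expo t)) powr q) \<partial>\<nu>') =
      (\<integral>\<^sup>+ t. ennreal (cmod (Lp_semi_inner p (\<mu> \<star> \<mu>') (P_op \<mu> \<mu>' f) (expo t)) powr q) \<partial>\<nu>)"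
    if f: "f \<in> Lp_space p \<mu>" for f
  proof -
    have fi: "integrable \<mu> f"
      using Lp_space_imp_integrable[OF _ _ f] assms(1,6) by (simp add: prob_space.finite_measure)
    note [measurable_cong] = assms(5)
    note [measurable] = borel_measurable_fourier_measure[OF assms(3,4)]
      borel_measurable_Lp_semi_inner_expo[OF assms(1,2) borel_measurable_integrable[OF fi]]
    have "(\<integral>\<^sup>+ t. ennreal (cmod (Lp_semi_inner p \<mu> f (expo t)) powr q) \<partial>\<nu>') =
        (\<integral>\<^sup>+ t. ennreal (cmod (fourier_measure \<mu>' t) powr q) *
          ennreal (cmod (Lp_semi_inner p \<mu> f (expo t)) powr q) \<partial>\<nu>)"
      unfolding \<nu>'_def by (rule nn_integral_density) measurable
    thus ?thesis
      by (simp add: Lp_semi_inner_P_op[OF assms(1-4) fi] norm_mult powr_mult ennreal_mult)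
  qed
  have Bessel: "Bessel_measure p q \<mu> \<nu>' B" if B: "Bessel_measure p q (\<mu> \<star> \<mu>') \<nu> B" for B
    unfolding Bessel_measure_def
  proof (intro conjI ballI)
    show "sets \<nu>' = sets borel" using assms(5) by (simp add: \<nu>'_def)
    show B0: "B > 0" using B by (simp add: Bessel_measure_def)
    fix f assume f: "f \<in> Lp_space p \<mu>"
    have "(\<integral>\<^sup>+ t. ennreal (cmod (Lp_semi_inner p \<mu> f (expo t)) powr q) \<partial>\<nu>')
        \<le> ennreal (B * Lp_norm p (\<mu> \<star> \<mu>') (P_op \<mu> \<mu>' f) powr q)"
      unfolding transfer[OF f] using B contr(1)[OF f] by (simp add: Bessel_measure_def)
    also have "\<dots> \<le> ennreal (B * Lp_norm p \<mu> f powr q)"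
      using B0 assms(7) contr(2)[OF f]
      by (intro ennreal_leI mult_left_mono powr_mono2) (auto simp: Lp_norm_def)
    finally show "(\<integral>\<^sup>+ t. ennreal (cmod (Lp_semi_inner p \<mu> f (expo t)) powr q) \<partial>\<nu>')
        \<le> ennreal (B * Lp_norm p \<mu> f powr q)" .
  qed
  have frame: "frame_measure p q \<mu> \<nu>' (c * A) B"
    if AB: "frame_measure p q (\<mu> \<star> \<mu>') \<nu> A B" and c: "c > 0"
      and lower: "\<forall>f\<in>Lp_space p \<mu>.
        c * Lp_norm p \<mu> f powr q \<le> Lp_norm p (\<mu> \<star> \<mu>') (P_op \<mu> \<mu>' f) powr q" for A B c
    unfolding frame_measure_def
  proof (intro conjI ballI)
    have A: "A > 0" using AB by (simp add: frame_measure_def)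
    show "Bessel_measure p q \<mu> \<nu>' B" using AB Bessel by (simp add: frame_measure_def)
    show "c * A > 0" using A c by simp
    fix f assume f: "f \<in> Lp_space p \<mu>"
    have "c * A * Lp_norm p \<mu> f powr q \<le> A * Lp_norm p (\<mu> \<star> \<mu>') (P_op \<mu> \<mu>' f) powr q"
      using mult_left_mono[OF bspec[OF lower f], of A] A by (simp add: ac_simps)
    hence "ennreal (c * A * Lp_norm p \<mu> f powr q)
        \<le> ennreal (A * Lp_norm p (\<mu> \<star> \<mu>') (P_op \<mu> \<mu>' f) powr q)"
      by (rule ennreal_leI)
    also have "\<dots> \<le> (\<integral>\<^sup>+ t. ennreal (cmod (Lp_semi_inner p \<mu> f (expo t)) powr q) \<partial>\<nu>')"
      unfolding transfer[OF f] using AB contr(1)[OF f] by (simp add: frame_measure_def)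
    finally show "ennreal (c * A * Lp_norm p \<mu> f powr q)
        \<le> (\<integral>\<^sup>+ t. ennreal (cmod (Lp_semi_inner p \<mu> f (expo t)) powr q) \<partial>\<nu>')" .
  qed
  show ?thesis using Bessel frame unfolding \<nu>'_def by blast
qed

end
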